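(* For any prime power $q$, and any $b,c\in\mathbb{F}_{q^2}$, the polynomial $f(X):=X^{q+2}+bX^q+cX$ permutes $\mathbb{F}_{q^2}$ if and only if one of the following holds: (1) $q\not\equiv 1\pmod 3$, $b=0$, and $c^{q-1}$ is a root of $X^3-X^2+X$; (2) $q=2$, $b\ne 0$, and $c=1$. *)

theory Defs
  imports "HOL-Computational_Algebra.Primes" "HOL-Library.Cardinality"
begin

end

theory Submission
  imports
    Defs
    "HOL-Computational_Algebra.Polynomial"
    "HOL-Number_Theory.Cong"
    "HOL-Number_Theory.Prime_Powers"
begin

text \<open>
  Write \<open>conj x = x ^ q\<close>, so that \<open>f x = x\<^sup>2 conj x + b conj x + c x\<close>. If \<open>f\<close> permutes the field,
  then by Hermite's criterion the sum of \<open>f x ^ i * conj (f x) ^ j\<close> over all \<open>x\<close> vanishes for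
  \<open>0 < i + q j < q\<^sup>2 - 1\<close>. For \<open>i\<close>, \<open>j\<close> near \<open>q / 3\<close>, the only monomial with a nonzero sum is
  \<open>x ^ (q - 1) * conj x ^ (q - 1)\<close>, and it lies so close to the top degree that its coefficient has
  only a few terms. For \<open>q mod 3 = 1\<close> a suitable such coefficient is \<open>1\<close>, which is absurd; otherwise,
  for \<open>q > 2\<close>, these coefficients force \<open>b = 0\<close> and, away from characteristic \<open>3\<close>, the relation
  \<open>(tr c)\<^sup>2 = 3 nm c\<close> between the trace and the norm of \<open>c\<close>, which says that \<open>c ^ (q - 1)\<close> is a root
  of \<open>X\<^sup>3 - X\<^sup>2 + X\<close>.

  If \<open>b = 0\<close>, then \<open>f x = x (nm x + c)\<close>, so \<open>f\<close> acts on norms by the cubic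
  \<open>t (t + c) (t + conj c) = t\<^sup>3 + tr c t\<^sup>2 + nm c t\<close> over the subfield of order \<open>q\<close>, and \<open>f\<close> is a
  permutation if and only if this cubic is injective there. Under the relation above the cubic is an
  affine image of a cube or, in characteristic \<open>3\<close>, additive with trivial kernel; in characteristic
  \<open>3\<close> a nonzero trace leads to an explicit collision.
\<close>

subsection \<open>Finite fields\<close>

lemma bij_iff_inj_if_finite:
  fixes g :: "'a::finite \<Rightarrow> 'a"
  shows "bij g \<longleftrightarrow> inj g"
  by (auto simp: bij_def finite_UNIV_inj_surj)

lemma finite_field_power_card_minus_1:
  fixes x :: "'a::{field, finite}"
  assumes "x \<noteq> 0"
  shows "x ^ (CARD('a) - 1) = 1"
proof -
  have "(\<Prod>y\<in>UNIV-{0}. y) = (\<Prod>y\<in>UNIV-{0}. x * y)"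
    by (rule prod.reindex_bij_witness[of _ "\<lambda>y. x * y" "\<lambda>y. y / x"]) (use assms in auto)
  also have "\<dots> = x ^ (CARD('a) - 1) * (\<Prod>y\<in>UNIV-{0}. y)"
    by (simp add: prod.distrib)
  finally show ?thesis
    by simp
qed

lemma of_nat_card_UNIV_eq_0: "of_nat CARD('a::{ring_1, finite}) = (0 :: 'a)"
proof -
  have "(\<Sum>x\<in>UNIV. x) = (\<Sum>x\<in>UNIV. x + 1 :: 'a)"
    by (rule sum.reindex_bij_witness[of _ "\<lambda>x. x + 1" "\<lambda>x. x - 1"]) auto
  thus ?thesis
    by (simp add: sum.distrib)
qed

lemma card_nth_roots_le:
  fixes a :: "'a::idom"
  assumes "n > 0"
  shows "card {x. x ^ n = a} \<le> n"
proof -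
  let ?P = "monom 1 n - [:a:]"
  have "degree ?P = n"
    using assms
    by (subst diff_conv_add_uminus, subst degree_add_eq_left) (auto simp: degree_monom_eq)
  moreover from this have "?P \<noteq> 0"
    using assms by auto
  ultimately have "card {x. poly ?P x = 0} \<le> n"
    using card_poly_roots_bound[of ?P] by simp
  thus ?thesis
    by (simp add: poly_monom)
qed

lemma finite_field_ex_power_ne_1:
  fixes m :: nat
  assumes "\<not> (CARD('a::{field, finite}) - 1) dvd m"
  obtains y :: "'a::{field, finite}" where "y \<noteq> 0" "y ^ m \<noteq> 1"
proof -
  let ?N = "CARD('a) - 1"
  have "?N > 0"
    using finite_UNIV_card_ge_0[where 'a = 'a] card_mono[of UNIV "{0, 1 :: 'a}"] by simp
  hence residue: "0 < m mod ?N" "m mod ?N < ?N"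
    using assms by (auto simp: dvd_eq_mod_eq_0)
  have "y ^ m = y ^ (m mod ?N)" if "y \<noteq> 0" for y :: 'a
  proof -
    have "y ^ m = y ^ (?N * (m div ?N) + m mod ?N)"
      by simp
    also have "\<dots> = y ^ (m mod ?N)"
      unfolding power_add power_mult finite_field_power_card_minus_1[OF that] by simp
    finally show ?thesis .
  qed
  moreover have "\<not> UNIV - {0} \<subseteq> {y :: 'a. y ^ (m mod ?N) = 1}"
  proof
    assume "UNIV - {0} \<subseteq> {y :: 'a. y ^ (m mod ?N) = 1}"
    hence "?N \<le> card {y :: 'a. y ^ (m mod ?N) = 1}"
      using card_mono[of "{y :: 'a. y ^ (m mod ?N) = 1}" "UNIV - {0}"] by simp
    with card_nth_roots_le[OF residue(1), of "1 :: 'a"] residue(2) show False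
      by simp
  qed
  ultimately show ?thesis
    using that by fastforce
qed

lemma finite_field_sum_power_nonzero:
  fixes m :: nat
  shows "(\<Sum>x\<in>UNIV - {0::'a::{field, finite}}. x ^ m) =
    (if (CARD('a) - 1) dvd m then -1 else 0)"
proof (cases "(CARD('a) - 1) dvd m")
  case True
  hence "(\<Sum>x\<in>UNIV - {0::'a}. x ^ m) = (\<Sum>x\<in>UNIV - {0::'a}. 1)"
    by (intro sum.cong) (auto elim!: dvdE
      simp: power_mult finite_field_power_card_minus_1[unfolded One_nat_def])
  also have "\<dots> = of_nat (CARD('a) - 1)"
    by simp
  also have "\<dots> = -1"
    by (simp add: of_nat_diff of_nat_card_UNIV_eq_0)
  finally show ?thesis
    using True by simp
next
  case False
  then obtain y :: 'a where y_power: "y \<noteq> 0" "y ^ m \<noteq> 1"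
    by (rule finite_field_ex_power_ne_1)
  have "(\<Sum>x\<in>UNIV - {0}. x ^ m) = (\<Sum>x\<in>UNIV - {0}. (y * x) ^ m)"
    by (rule sum.reindex_bij_witness[of _ "\<lambda>x. y * x" "\<lambda>x. x / y"]) (use y_power in auto)
  also have "\<dots> = y ^ m * (\<Sum>x\<in>UNIV - {0}. x ^ m)"
    by (simp add: power_mult_distrib sum_distrib_left)
  finally show ?thesis
    using y_power(2) False by simp
qed

lemma bij_imp_sum_power_eq_0:
  fixes f :: "'a::{field, finite} \<Rightarrow> 'a"
  assumes "bij f" "\<not> (CARD('a) - 1) dvd m"
  shows "(\<Sum>x\<in>UNIV. f x ^ m) = 0"
proof -
  have "(\<Sum>x\<in>UNIV. f x ^ m) = (\<Sum>x\<in>UNIV. x ^ m)"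
    using assms(1) by (rule sum.reindex_bij_betw)
  also have "\<dots> = (\<Sum>x\<in>UNIV - {0}. x ^ m)"
    by (rule sum.mono_neutral_right) (use assms(2) in \<open>auto intro: gr0I\<close>)
  also have "\<dots> = 0"
    using assms(2) by (simp add: finite_field_sum_power_nonzero)
  finally show ?thesis .
qed

lemma finite_field_ex_nth_root:
  fixes y :: "'a::{field, finite}"
  assumes card: "CARD('a) - 1 = m * n" and "m > 0" "n > 0" "y ^ m = 1"
  obtains x where "x ^ n = y"
proof -
  define S :: "'a set" where "S = (\<lambda>x. x ^ n) ` (UNIV - {0})"
  have "S \<subseteq> {z. z ^ m = 1}"
  proof (clarsimp simp: S_def)
    fix x :: 'a assume "x \<noteq> 0"
    thus "(x ^ n) ^ m = 1"
      using finite_field_power_card_minus_1[of x] card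
      by (simp add: mult.commute flip: power_mult)
  qed
  moreover have "card {z :: 'a. z ^ m = 1} \<le> card S"
  proof -
    have "m * n = card (UNIV - {0 :: 'a})"
      using card by simp
    also have "UNIV - {0 :: 'a} \<subseteq> (\<Union>s\<in>S. {x. x ^ n = s})"
      by (auto simp: S_def)
    hence "card (UNIV - {0 :: 'a}) \<le> card (\<Union>s\<in>S. {x. x ^ n = s})"
      by (intro card_mono) auto
    also have "\<dots> \<le> (\<Sum>s\<in>S. card {x. x ^ n = s})"
      by (rule card_UN_le) simp
    also have "\<dots> \<le> (\<Sum>s\<in>S. n)"
      by (intro sum_mono card_nth_roots_le \<open>n > 0\<close>)
    finally have "m \<le> card S"
      using \<open>n > 0\<close> by simp
    with card_nth_roots_le[OF \<open>m > 0\<close>, of "1 :: 'a"] show ?thesis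
      by simp
  qed
  ultimately have "S = {z. z ^ m = 1}"
    by (intro card_seteq) auto
  hence "y \<in> S"
    using \<open>y ^ m = 1\<close> by simp
  thus ?thesis
    using that by (auto simp: S_def)
qed

subsection \<open>Binomial coefficients and binary forms\<close>

lemma prime_dvd_choose_if_prime_power_dvd:
  fixes p n k :: nat
  assumes "prime p" "p ^ e dvd n" "0 < k" "k < p ^ e"
  shows "p dvd (n choose k)"
proof (rule ccontr)
  assume "\<not> p dvd (n choose k)"
  hence "coprime (p ^ e) (n choose k)"
    using assms(1) by (simp add: prime_imp_coprime)
  moreover have "k * (n choose k) = n * ((n - 1) choose (k - 1))"
    using binomial_absorption[of "k - 1" n] assms(3) by simp
  hence "p ^ e dvd k * (n choose k)"
    using assms(2) by simp
  ultimately have "p ^ e dvd k"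
    using coprime_dvd_mult_left_iff by blast
  thus False
    using assms(3,4) by (auto dest: dvd_imp_le)
qed

lemma choose_add_cong_if_prime_power_dvd:
  fixes p m n k :: nat
  assumes "prime p" "p ^ e dvd m" "k < p ^ e"
  shows "[(m + n) choose k = n choose k] (mod p)"
proof -
  have "[(\<Sum>i\<in>{0<..k}. (m choose i) * (n choose (k - i))) = (\<Sum>i\<in>{0<..k}. 0)] (mod p)"
    using assms prime_dvd_choose_if_prime_power_dvd[OF assms(1,2)]
    by (intro cong_sum) (simp add: cong_0_iff)
  moreover have "(m + n) choose k =
      (n choose k) + (\<Sum>i\<in>{0<..k}. (m choose i) * (n choose (k - i)))"
  proof -
    have "{..k} = insert 0 {0<..k}"
      by auto
    thus ?thesis
      by (simp flip: vandermonde)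
  qed
  ultimately show ?thesis
    using cong_add_lcancel_0_nat by simp
qed

lemma two_mult_choose_two: "2 * (n choose 2) = n * (n - 1)"
  using binomial_absorption[of 1 n] by (simp add: numeral_2_eq_2)

lemma degree_linear_power_mult:
  fixes a b c d :: "'a::comm_semiring_1"
  shows "degree ([:a, b:] ^ r * [:c, d:] ^ s) \<le> r + s"
proof -
  have "degree ([:a, b:] ^ r * [:c, d:] ^ s) \<le> degree ([:a, b:] ^ r) + degree ([:c, d:] ^ s)"
    by (rule degree_mult_le)
  also have "\<dots> \<le> r + s"
    using degree_power_le[of "[:a, b:]" r] degree_power_le[of "[:c, d:]" s]
    by (auto split: if_splits)
  finally show ?thesis .
qed

lemma linear_forms_power_mult:
  fixes x y :: "'a::field"
  assumes "x \<noteq> 0"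
  shows "(a * x + b * y) ^ r * (c * x + d * y) ^ s =
    (\<Sum>k\<le>r + s. coeff ([:a, b:] ^ r * [:c, d:] ^ s) k * (x ^ (r + s - k) * y ^ k))"
proof -
  let ?P = "[:a, b:] ^ r * [:c, d:] ^ s"
  have "a * x + b * y = x * (a + b * (y / x))" "c * x + d * y = x * (c + d * (y / x))"
    using assms by (simp_all add: field_simps)
  hence "(a * x + b * y) ^ r * (c * x + d * y) ^ s =
      (x * (a + b * (y / x))) ^ r * (x * (c + d * (y / x))) ^ s"
    by (simp only:)
  also have "\<dots> = x ^ (r + s) * poly ?P (y / x)"
    by (simp only: power_mult_distrib power_add) (simp add: mult_ac)
  also have "poly ?P (y / x) = (\<Sum>k\<le>r + s. coeff ?P k * (y / x) ^ k)"
    unfolding poly_altdef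
    by (rule sum.mono_neutral_left)
      (use degree_linear_power_mult[of a b r c d s] in \<open>auto simp: coeff_eq_0\<close>)
  also have "x ^ (r + s) * \<dots> = (\<Sum>k\<le>r + s. coeff ?P k * (x ^ (r + s - k) * y ^ k))"
    unfolding sum_distrib_left
    by (rule sum.cong) (use assms in \<open>auto simp: power_diff power_divide\<close>)
  finally show ?thesis .
qed

lemma sum_antidiagonal:
  fixes g :: "nat \<Rightarrow> nat \<Rightarrow> 'a::comm_monoid_add"
  assumes "\<And>r s. r > i \<or> s > j \<Longrightarrow> g r s = 0"
  shows "(\<Sum>r\<le>i. \<Sum>s\<le>j. if r + s = R then g r s else 0) = (\<Sum>r\<le>R. g r (R - r))"
proof -
  have "(\<Sum>s\<le>j. if r + s = R then g r s else 0) = (if r \<le> R then g r (R - r) else 0)" for r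
  proof (cases "r \<le> R")
    case True
    hence "(\<Sum>s\<le>j. if r + s = R then g r s else 0) = (\<Sum>s\<le>j. if s = R - r then g r s else 0)"
      by (intro sum.cong) auto
    thus ?thesis
      using True assms[of r "R - r"] by simp
  qed simp
  hence "(\<Sum>r\<le>i. \<Sum>s\<le>j. if r + s = R then g r s else 0) = (\<Sum>r\<in>{..i} \<inter> {..R}. g r (R - r))"
    by (simp add: sum.inter_restrict del: Int_atMost)
  also have "\<dots> = (\<Sum>r\<le>R. g r (R - r))"
    by (rule sum.mono_neutral_left) (auto simp: not_le intro: assms)
  finally show ?thesis .
qed

lemma add_mult_eq_iff_digits:
  fixes q a l :: nat
  assumes "q > 0" "a \<le> 2 * (q - 1)"
  shows "a + q * l = (q - 1) + q * (q - 1) \<longleftrightarrow> a = q - 1 \<and> l = q - 1"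
proof
  assume eq: "a + q * l = (q - 1) + q * (q - 1)"
  hence "a mod q = (q - 1) mod q"
    by (metis mod_mult_self2)
  hence "a = q - 1"
    using assms by (cases "a < q") (auto simp: mod_if not_less split: if_splits)
  moreover from this have "q * l = q * (q - 1)"
    using eq by (simp only: add_left_cancel)
  hence "l = q - 1"
    using \<open>q > 0\<close> by simp
  ultimately show "a = q - 1 \<and> l = q - 1" ..
qed simp

lemma square_minus_1_dvd_iff:
  fixes q a l :: nat
  assumes "q \<ge> 2" "a \<le> 2 * (q - 1)" "l \<le> 2 * (q - 1)" "0 < a + l" "a + l < 4 * (q - 1)"
  shows "(q ^ 2 - 1) dvd a + q * l \<longleftrightarrow> a = q - 1 \<and> l = q - 1"
proof -
  define n where "n = q - 1"
  have square_minus_1: "q ^ 2 - 1 = n + q * n"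
    using assms(1) by (simp add: n_def power2_eq_square diff_mult_distrib2)
  obtain x y where complements: "2 * n = a + x" "2 * n = l + y"
    using assms(2,3) unfolding n_def by (meson le_iff_add)
  have "(n + q * n) * 2 = 2 * n + q * (2 * n)"
    by simp
  also have "\<dots> = (a + x) + q * (l + y)"
    by (simp only: complements(1)[symmetric] complements(2)[symmetric])
  also have "\<dots> = (a + q * l) + (x + q * y)"
    by (simp add: distrib_left)
  finally have "(n + q * n) * 2 = (a + q * l) + (x + q * y)" .
  moreover have "0 < x + q * y"
    using complements assms(1) assms(5)[folded n_def] by (intro gr0I) auto
  ultimately have upper: "a + q * l < (n + q * n) * 2"
    by linarith
  show ?thesis
  proof
    assume "(q ^ 2 - 1) dvd a + q * l"
    then obtain t where quotient: "a + q * l = (n + q * n) * t"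
      unfolding square_minus_1 by (elim dvdE)
    have "(n + q * n) * t < (n + q * n) * 2"
      using upper quotient by simp
    hence "t < 2"
      by (simp only: mult_less_cancel1)
    moreover have "t \<noteq> 0"
      using quotient assms(1,4) by (intro notI) simp
    ultimately have "t = 1"
      by simp
    thus "a = q - 1 \<and> l = q - 1"
      using quotient add_mult_eq_iff_digits[of q a l] assms(1,2) by (simp add: n_def)
  qed (simp only: square_minus_1 n_def dvd_refl)
qed

subsection \<open>Conjugation, trace and norm\<close>

locale quadratic_finite_field =
  fixes q :: nat and conj :: "'a::{field, finite} \<Rightarrow> 'a"
  assumes primepow_q: "primepow q" and card_eq: "CARD('a) = q ^ 2"
    and conj_eq: "conj x = x ^ q"
begin

abbreviation base_field :: "'a set" where "base_field \<equiv> {t. conj t = t}"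

definition tr :: "'a \<Rightarrow> 'a" where "tr x = x + conj x"

definition nm :: "'a \<Rightarrow> 'a" where "nm x = x * conj x"

lemma q_ge_2: "q \<ge> 2"
  using primepow_gt_Suc_0[OF primepow_q] by simp

lemma prime_CHAR: "prime CHAR('a)"
  using prime_CHAR_semidom finite_imp_CHAR_pos[where 'a = 'a] by simp

lemma q_eq_CHAR_power: obtains e where "e > 0" "q = CHAR('a) ^ e"
proof -
  obtain p e where q_power: "prime p" "e > 0" "q = p ^ e"
    using primepow_q by (auto simp: primepow_def)
  have "CHAR('a) dvd (p ^ e) ^ 2"
    using of_nat_card_UNIV_eq_0[where 'a = 'a]
    unfolding of_nat_eq_0_iff_char_dvd card_eq q_power(3) .
  hence "CHAR('a) = p"
    using prime_CHAR q_power(1) prime_dvd_power primes_dvd_imp_eq by blast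
  thus ?thesis
    using that q_power by blast
qed

lemma of_nat_q: "of_nat q = (0 :: 'a)"
  using q_eq_CHAR_power by (metis of_nat_CHAR of_nat_power zero_power)

lemma CHAR_eq_if_prime_dvd_q:
  assumes "prime p" "p dvd q"
  shows "CHAR('a) = p"
  using assms q_eq_CHAR_power prime_CHAR by (metis prime_dvd_power primes_dvd_imp_eq)

lemma CHAR_eq_2_if_two_eq_0:
  assumes "(2 :: 'a) = 0"
  shows "CHAR('a) = 2"
proof -
  have "of_nat 2 = (0 :: 'a)"
    using assms by simp
  thus ?thesis
    using prime_CHAR primes_dvd_imp_eq two_is_prime_nat
    unfolding of_nat_eq_0_iff_char_dvd by blast
qed

lemma conj_add [simp]: "conj (x + y) = conj x + conj y"
  unfolding conj_eq using q_eq_CHAR_power by (metis freshmans_dream' prime_CHAR)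

lemma conj_mult [simp]: "conj (x * y) = conj x * conj y"
  by (simp add: conj_eq power_mult_distrib)

lemma conj_divide [simp]: "conj (x / y) = conj x / conj y"
  by (simp add: conj_eq power_divide)

lemma conj_power [simp]: "conj (x ^ n) = conj x ^ n"
  by (simp add: conj_eq mult.commute flip: power_mult)

lemma conj_0 [simp]: "conj 0 = 0"
  using q_ge_2 by (simp add: conj_eq)

lemma conj_1 [simp]: "conj 1 = 1"
  by (simp add: conj_eq)

lemma conj_eq_0_iff [simp]: "conj x = 0 \<longleftrightarrow> x = 0"
  using q_ge_2 by (simp add: conj_eq)

lemma conj_diff [simp]: "conj (x - y) = conj x - conj y"
  using conj_add[of "x - y" y] by (simp add: eq_diff_eq del: conj_add)

lemma conj_minus [simp]: "conj (- x) = - conj x"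
  using conj_diff[of 0 x] by simp

lemma conj_numeral [simp]: "conj (numeral n) = numeral n"
proof -
  have "conj (of_nat m) = of_nat m" for m
    by (induction m) simp_all
  thus ?thesis
    by (metis of_nat_numeral)
qed

lemma conj_conj [simp]: "conj (conj x) = x"
proof (cases "x = 0")
  case False
  have "conj (conj x) = x ^ CARD('a)"
    by (simp add: conj_eq card_eq power2_eq_square flip: power_mult)
  also have "CARD('a) = Suc (CARD('a) - 1)"
    by simp
  also have "x ^ \<dots> = x"
    by (simp only: power_Suc finite_field_power_card_minus_1[OF False] mult_1_right)
  finally show ?thesis .
qed simp

lemma conj_tr [simp]: "conj (tr x) = tr x"
  by (simp add: tr_def add.commute)

lemma conj_nm [simp]: "conj (nm x) = nm x"
  by (simp add: nm_def mult.commute)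

lemma nm_0 [simp]: "nm 0 = 0"
  by (simp add: nm_def)

lemma nm_eq_0_iff [simp]: "nm x = 0 \<longleftrightarrow> x = 0"
  by (simp add: nm_def)

lemma nm_mult: "nm (x * y) = nm x * nm y"
  by (simp add: nm_def mult_ac)

lemma nm_divide: "nm (x / y) = nm x / nm y"
  by (simp add: nm_def)

lemma card_minus_1_eq: "CARD('a) - 1 = (q - 1) * (q + 1)"
  using q_ge_2 by (simp add: card_eq power2_eq_square algebra_simps)

lemma power_q_minus_1_eq: "x \<noteq> 0 \<Longrightarrow> x ^ (q - 1) = conj x / x"
  using q_ge_2 by (simp add: conj_eq power_diff)

lemma ex_nm_eq_if_conj_eq:
  assumes "conj t = t"
  shows "\<exists>x. nm x = t"
proof (cases "t = 0")
  case False
  hence "t ^ (q - 1) = 1"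
    using assms power_q_minus_1_eq[OF False] by simp
  then obtain x where "x ^ (q + 1) = t"
    using finite_field_ex_nth_root[OF card_minus_1_eq] q_ge_2 by auto
  hence "nm x = t"
    by (simp add: nm_def conj_eq)
  thus ?thesis ..
qed (auto intro: exI[of _ 0])

lemma sum_monomial:
  assumes "a \<le> 2 * (q - 1)" "l \<le> 2 * (q - 1)" "0 < a + l" "a + l < 4 * (q - 1)"
  shows "(\<Sum>x\<in>UNIV - {0}. x ^ a * conj x ^ l) = (if a = q - 1 \<and> l = q - 1 then -1 else 0)"
proof -
  have "(\<Sum>x\<in>UNIV - {0}. x ^ a * conj x ^ l) = (\<Sum>x\<in>UNIV - {0 :: 'a}. x ^ (a + q * l))"
    by (simp add: conj_eq power_add power_mult)
  thus ?thesis
    using square_minus_1_dvd_iff[OF q_ge_2 assms]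
    by (simp add: finite_field_sum_power_nonzero card_eq)
qed

lemma cube_inj_on_base_field:
  assumes "q mod 3 = 2"
  shows "inj_on (\<lambda>t. t ^ 3) base_field"
proof (rule inj_on_inverseI)
  fix t assume "t \<in> base_field"
  hence fixed: "t ^ q = t"
    by (simp add: conj_eq)
  define k where "k = q div 3"
  have q_eq: "q = 3 * k + 2"
    using assms by (simp add: k_def) presburger
  have "3 * (2 * k + 1) = q + (3 * k + 1)"
    by (simp add: q_eq)
  hence "(t ^ 3) ^ (2 * k + 1) = t ^ q * t ^ (3 * k + 1)"
    by (metis power_mult power_add)
  also have "\<dots> = t * t ^ (3 * k + 1)"
    by (simp only: fixed)
  also have "\<dots> = t ^ q"
    by (simp add: q_eq)
  finally show "(t ^ 3) ^ (2 * k + 1) = t"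
    by (simp only: fixed)
qed

definition norm_cubic :: "'a \<Rightarrow> 'a \<Rightarrow> 'a" where
  "norm_cubic c t = t * (t + c) * (t + conj c)"

lemma norm_cubic_eq: "norm_cubic c t = t ^ 3 + tr c * t ^ 2 + nm c * t"
  by (simp add: norm_cubic_def tr_def nm_def algebra_simps power2_eq_square power3_eq_cube)

lemma inj_on_norm_cubic_if_three_ne_0:
  assumes "q mod 3 = 2" "(3 :: 'a) \<noteq> 0" "tr c ^ 2 = 3 * nm c"
  shows "inj_on (norm_cubic c) base_field"
proof (rule inj_onI)
  fix t u assume tu: "t \<in> base_field" "u \<in> base_field" "norm_cubic c t = norm_cubic c u"
  have cube: "(3 * v + tr c) ^ 3 = 27 * norm_cubic c v + tr c ^ 3" for v
  proof -
    have "(3 * v + tr c) ^ 3 = 27 * v ^ 3 + 27 * tr c * v ^ 2 + 9 * v * tr c ^ 2 + tr c ^ 3"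
      by (simp add: algebra_simps power2_eq_square power3_eq_cube)
    thus ?thesis
      by (simp add: norm_cubic_eq assms(3) algebra_simps)
  qed
  have "3 * t + tr c = 3 * u + tr c"
    by (rule inj_onD[OF cube_inj_on_base_field[OF assms(1)]]) (use tu cube in auto)
  thus "t = u"
    using assms(2) by simp
qed

lemma inj_on_norm_cubic_if_three_eq_0:
  assumes "(3 :: 'a) = 0" "tr c = 0"
  shows "inj_on (norm_cubic c) base_field"
proof (rule inj_onI)
  fix t u assume tu: "t \<in> base_field" "u \<in> base_field" "norm_cubic c t = norm_cubic c u"
  have conj_c: "conj c = - c"
    using assms(2) by (simp add: tr_def eq_neg_iff_add_eq_0 add.commute)
  have "norm_cubic c (t - u) = norm_cubic c t - norm_cubic c u - 3 * (t ^ 2 * u - t * u ^ 2)"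
    unfolding norm_cubic_eq assms(2) by (simp add: algebra_simps power2_eq_square power3_eq_cube)
  also have "\<dots> = 0"
    using tu(3) assms(1) by simp
  finally have "t - u = 0 \<or> t - u = - c \<or> t - u = c"
    by (auto simp: norm_cubic_def conj_c eq_neg_iff_add_eq_0)
  moreover have "conj (t - u) = t - u"
    using tu by simp
  moreover have "c = 0" if "conj c = c"
  proof -
    have "c = 3 * c - (c + c)"
      by simp
    also have "c + c = tr c"
      by (simp add: tr_def that)
    finally show ?thesis
      using assms by simp
  qed
  ultimately show "t = u"
    by fastforce
qed

lemma inj_on_norm_cubic:
  assumes "q mod 3 \<noteq> 1" "tr c ^ 2 = 3 * nm c"
  shows "inj_on (norm_cubic c) base_field"
proof (cases "(3 :: 'a) = 0")
  case True
  thus ?thesis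
    using assms(2) by (intro inj_on_norm_cubic_if_three_eq_0) auto
next
  case False
  have "\<not> 3 dvd q"
    using False CHAR_eq_if_prime_dvd_q[of 3] of_nat_CHAR[where 'a = 'a] by fastforce
  hence "q mod 3 = 2"
    using assms(1) by presburger
  thus ?thesis
    using False assms(2) by (rule inj_on_norm_cubic_if_three_ne_0)
qed

lemma tr_eq_0_if_inj_on_norm_cubic:
  assumes "(3 :: 'a) = 0" "inj_on (norm_cubic c) base_field"
  shows "tr c = 0"
proof (rule ccontr)
  assume tr_ne_0: "tr c \<noteq> 0"
  define h where "h = nm c / tr c"
    \<comment> \<open>then \<open>norm_cubic c (h + u) - norm_cubic c h = u\<^sup>2 (u + tr c)\<close> in characteristic \<open>3\<close>\<close>
  have "norm_cubic c h - norm_cubic c (h - tr c) =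
      3 * (h ^ 2 * tr c - h * tr c ^ 2 + nm c * tr c)"
  proof -
    have "nm c = h * tr c"
      using tr_ne_0 by (simp add: h_def)
    thus ?thesis
      unfolding norm_cubic_eq by (simp add: algebra_simps power2_eq_square power3_eq_cube)
  qed
  hence "norm_cubic c h = norm_cubic c (h - tr c)"
    using assms(1) by simp
  hence "h = h - tr c"
    by (rule inj_onD[OF assms(2)]) (simp_all add: h_def)
  thus False
    using tr_ne_0 by simp
qed

lemma tr_square_eq_if_q_eq_2:
  assumes "q = 2" "c \<noteq> 1"
  shows "tr c ^ 2 = 3 * nm c"
proof -
  have two_eq_0: "(2 :: 'a) = 0"
    using of_nat_q assms(1) by simp
  have c_power_4: "c ^ 4 = c"
    using conj_conj[of c] by (simp add: conj_eq assms(1) flip: power_mult)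
  have "(c - 1) * (tr c ^ 2 - 3 * nm c) = (c ^ 4 - c) * c + 2 * (c ^ 3 - c ^ 4)"
    unfolding tr_def nm_def conj_eq assms(1) using c_power_4
    by (simp add: algebra_simps power2_eq_square power3_eq_cube power4_eq_xxxx)
  hence "(c - 1) * (tr c ^ 2 - 3 * nm c) = 0"
    by (simp add: two_eq_0 c_power_4)
  thus ?thesis
    using assms(2) by simp
qed

lemma root_iff_tr_square_eq:
  "(c ^ (q - 1)) ^ 3 - (c ^ (q - 1)) ^ 2 + c ^ (q - 1) = 0 \<longleftrightarrow> tr c ^ 2 = 3 * nm c"
proof (cases "c = 0")
  case True
  thus ?thesis
    using q_ge_2 by (simp add: tr_def power_0_left)
next
  case False
  define u where "u = c ^ (q - 1)"
  have conj_c: "conj c = c * u" and "u \<noteq> 0"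
    using False power_q_minus_1_eq[OF False] by (simp_all add: u_def)
  have "u ^ 3 - u ^ 2 + u = u * (u ^ 2 - u + 1)"
    by (simp add: algebra_simps power2_eq_square power3_eq_cube)
  moreover have "tr c ^ 2 - 3 * nm c = c ^ 2 * (u ^ 2 - u + 1)"
    unfolding tr_def nm_def conj_c by (simp add: algebra_simps power2_eq_square)
  ultimately show ?thesis
    unfolding u_def[symmetric] using False \<open>u \<noteq> 0\<close>
    by (simp flip: right_minus_eq[of "tr c ^ 2"])
qed

end

subsection \<open>Hermite sums of the trinomial\<close>

locale trinomial = quadratic_finite_field q conj
  for q and conj :: "'a::{field, finite} \<Rightarrow> 'a" +
  fixes b c :: 'a
begin

definition f :: "'a \<Rightarrow> 'a" where "f x = x ^ 2 * conj x + b * conj x + c * x"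

lemma f_0 [simp]: "f 0 = 0"
  by (simp add: f_def)

text \<open>
  In the expansion of \<open>f x ^ i * conj (f x) ^ j\<close>, the indices \<open>r\<close> and \<open>s\<close> count the factors \<open>f x\<close>
  and \<open>conj (f x)\<close> that contribute their linear form in \<open>x\<close> and \<open>conj x\<close> rather than their cubic
  summand; \<open>k\<close> is the exponent of \<open>conj x\<close> in the product of these linear forms.
\<close>

definition expansion_coeff :: "nat \<Rightarrow> nat \<Rightarrow> nat \<Rightarrow> nat \<Rightarrow> nat \<Rightarrow> 'a" where
  "expansion_coeff i j r s k = of_nat ((i choose r) * (j choose s)) *
    coeff ([:c, b:] ^ r * [:conj b, conj c:] ^ s) k"

definition expansion_monomial :: "nat \<Rightarrow> nat \<Rightarrow> nat \<Rightarrow> nat \<Rightarrow> nat \<Rightarrow> 'a \<Rightarrow> 'a" where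
  "expansion_monomial i j r s k x =
    x ^ (2 * (i - r) + (j - s) + (r + s - k)) * conj x ^ ((i - r) + 2 * (j - s) + k)"

lemma expansion_coeff_eq_0:
  assumes "r > i \<or> s > j \<or> k > r + s"
  shows "expansion_coeff i j r s k = 0"
  using assms degree_linear_power_mult[of c b r "conj b" "conj c" s]
  by (auto simp: expansion_coeff_def coeff_eq_0 binomial_eq_0)

lemma power_f_expand:
  assumes "x \<noteq> 0"
  shows "f x ^ i * conj (f x) ^ j =
    (\<Sum>r\<le>i. \<Sum>s\<le>j. \<Sum>k\<le>r + s. expansion_coeff i j r s k * expansion_monomial i j r s k x)"
proof -
  define y where "y = conj x"
  have "f x = (c * x + b * y) + x ^ 2 * y" "conj (f x) = (conj b * x + conj c * y) + x * y ^ 2"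
    by (simp_all add: f_def y_def algebra_simps)
  hence "f x ^ i * conj (f x) ^ j = (\<Sum>r\<le>i. \<Sum>s\<le>j.
      (of_nat (i choose r) * (c * x + b * y) ^ r * (x ^ 2 * y) ^ (i - r)) *
      (of_nat (j choose s) * (conj b * x + conj c * y) ^ s * (x * y ^ 2) ^ (j - s)))"
    by (simp only: binomial_ring sum_product)
  also have "\<dots> = (\<Sum>r\<le>i. \<Sum>s\<le>j. of_nat ((i choose r) * (j choose s)) *
      ((c * x + b * y) ^ r * (conj b * x + conj c * y) ^ s) *
      (x ^ (2 * (i - r) + (j - s)) * y ^ ((i - r) + 2 * (j - s))))"
    by (simp only: power_add power_mult power_mult_distrib of_nat_mult) (simp only: mult_ac)
  also have "\<dots> =
      (\<Sum>r\<le>i. \<Sum>s\<le>j. \<Sum>k\<le>r + s. expansion_coeff i j r s k * expansion_monomial i j r s k x)"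
    unfolding linear_forms_power_mult[OF assms] sum_distrib_left sum_distrib_right
      expansion_coeff_def expansion_monomial_def y_def[symmetric]
    by (simp only: power_add mult_ac)
  finally show ?thesis .
qed

lemma sum_expansion_monomial:
  assumes "q - 1 + R = 3 * (j + d)" "R + d \<le> q - 1" "R < q - 1"
    and i_eq: "i = j + 2 * d" and index_le: "r \<le> i" "s \<le> j" "k \<le> r + s"
  shows "(\<Sum>x\<in>UNIV - {0}. expansion_monomial i j r s k x) =
    (if r + s = R \<and> k = d + s then -1 else 0)"
proof -
  obtain i' j' k' where index_eq: "i = r + i'" "j = s + j'" "r + s = k + k'"
    using index_le by (meson le_iff_add)
  define a l n where "a = 2 * i' + j' + k'" and "l = i' + 2 * j' + k" and "n = q - 1"
  note bounds = assms(1-3)[folded n_def]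
  have "a \<le> 2 * n" "l \<le> 2 * n"
    using bounds i_eq index_eq by (simp_all add: a_def l_def)
  moreover have "0 < a + l" "a + l < 4 * n"
    using bounds i_eq index_eq by (auto simp: a_def l_def)
  ultimately have "(\<Sum>x\<in>UNIV - {0}. x ^ a * conj x ^ l) = (if a = n \<and> l = n then -1 else 0)"
    unfolding n_def by (rule sum_monomial)
  moreover have "a = n \<and> l = n \<longleftrightarrow> r + s = R \<and> k = d + s"
    using bounds(1) i_eq index_eq by (auto simp: a_def l_def)
  moreover have "expansion_monomial i j r s k x = x ^ a * conj x ^ l" for x
    by (simp add: expansion_monomial_def a_def l_def index_eq)
  ultimately show ?thesis
    by (simp only:)
qed

definition hermite_coeff :: "nat \<Rightarrow> nat \<Rightarrow> nat \<Rightarrow> 'a" where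
  "hermite_coeff j d R = (\<Sum>r\<le>R. expansion_coeff (j + 2 * d) j r (R - r) (d + (R - r)))"

lemma sum_power_f_eq_hermite_coeff:
  assumes "q - 1 + R = 3 * (j + d)" "R + d \<le> q - 1" "R < q - 1"
  shows "(\<Sum>x\<in>UNIV - {0}. f x ^ (j + 2 * d) * conj (f x) ^ j) = - hermite_coeff j d R"
proof -
  define i where "i = j + 2 * d"
  let ?C = "expansion_coeff i j" and ?X = "expansion_monomial i j"
  have "(\<Sum>x\<in>UNIV - {0}. f x ^ i * conj (f x) ^ j) =
      (\<Sum>x\<in>UNIV - {0}. \<Sum>r\<le>i. \<Sum>s\<le>j. \<Sum>k\<le>r + s. ?C r s k * ?X r s k x)"
    by (rule sum.cong[OF refl], rule power_f_expand) simp
  also have "\<dots> = (\<Sum>r\<le>i. \<Sum>s\<le>j. \<Sum>k\<le>r + s. ?C r s k * (\<Sum>x\<in>UNIV - {0}. ?X r s k x))"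
    unfolding sum_distrib_left by (subst sum.swap, rule sum.cong[OF refl])+ (rule refl)
  also have "\<dots> = (\<Sum>r\<le>i. \<Sum>s\<le>j. if r + s = R then - ?C r s (d + s) else 0)"
  proof (intro sum.cong refl)
    fix r s assume "r \<in> {..i}" "s \<in> {..j}"
    hence "(\<Sum>k\<le>r + s. ?C r s k * (\<Sum>x\<in>UNIV - {0}. ?X r s k x)) =
        (\<Sum>k\<le>r + s. if k = d + s then if r + s = R then - ?C r s k else 0 else 0)"
      by (intro sum.cong refl) (simp add: sum_expansion_monomial[OF assms i_def])
    thus "(\<Sum>k\<le>r + s. ?C r s k * (\<Sum>x\<in>UNIV - {0}. ?X r s k x)) =
        (if r + s = R then - ?C r s (d + s) else 0)"
      using expansion_coeff_eq_0 by auto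
  qed
  also have "\<dots> = (\<Sum>r\<le>R. - ?C r (R - r) (d + (R - r)))"
    by (rule sum_antidiagonal) (use expansion_coeff_eq_0 in auto)
  also have "\<dots> = - hermite_coeff j d R"
    by (simp add: hermite_coeff_def i_def sum_negf)
  finally show ?thesis
    by (simp add: i_def)
qed

lemma hermite_coeff_eq_0:
  assumes "bij f" and deg: "q - 1 + R = 3 * (j + d)" and index_bounds: "R + d \<le> q - 1" "R < q - 1"
  shows "hermite_coeff j d R = 0"
proof -
  let ?m = "j + 2 * d + q * j"
  have exponent_bounds: "j + 2 * d \<le> 2 * (q - 1)" "j \<le> 2 * (q - 1)"
      "0 < j + 2 * d + j" "j + 2 * d + j < 4 * (q - 1)"
    and not_top: "\<not> (j + 2 * d = q - 1 \<and> j = q - 1)"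
    using deg index_bounds by auto
  have "?m > 0"
    using exponent_bounds(3) by simp
  have "0 = (\<Sum>x\<in>UNIV. f x ^ ?m)"
    using bij_imp_sum_power_eq_0[OF assms(1)] square_minus_1_dvd_iff[OF q_ge_2 exponent_bounds] not_top
    by (simp add: card_eq)
  also have "\<dots> = (\<Sum>x\<in>UNIV - {0}. f x ^ ?m)"
    using \<open>?m > 0\<close> by (intro sum.mono_neutral_right) auto
  also have "\<dots> = (\<Sum>x\<in>UNIV - {0}. f x ^ (j + 2 * d) * conj (f x) ^ j)"
    by (simp only: power_add power_mult conj_eq)
  also have "\<dots> = - hermite_coeff j d R"
    using deg index_bounds by (rule sum_power_f_eq_hermite_coeff)
  finally show ?thesis
    by simp
qed

lemma not_bij_if_mod_3_eq_1:
  assumes "q mod 3 = 1"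
  shows "\<not> bij f"
proof
  assume "bij f"
  define k where "k = q div 3"
  have q_eq: "q = 3 * k + 1"
    using assms by (simp add: k_def) presburger
  have "hermite_coeff k 0 0 = 0"
    using \<open>bij f\<close> q_eq q_ge_2 by (intro hermite_coeff_eq_0) auto
  thus False
    by (simp add: hermite_coeff_def expansion_coeff_def)
qed

lemma b_eq_0_if_three_dvd:
  assumes "bij f" "3 dvd q"
  shows "b = 0"
proof -
  have CHAR: "CHAR('a) = 3"
    using assms(2) by (intro CHAR_eq_if_prime_dvd_q) auto
  then obtain e where q_power: "e > 0" "q = 3 ^ e"
    using q_eq_CHAR_power by metis
  define k where "k = 3 ^ (e - 1) - (1 :: nat)"
  have Suc_k: "k + 1 = 3 ^ (e - 1)"
    by (simp add: k_def)
  hence q_eq: "q = 3 * k + 3"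
    using q_power by (cases e) auto
  have "k + 1 = 1 \<or> 3 dvd k + 1"
    unfolding Suc_k by (cases "e - 1") auto
  hence "\<not> 3 dvd k + 2"
    by presburger
  hence "of_nat (k + 2) \<noteq> (0 :: 'a)"
    by (simp only: of_nat_eq_0_iff_char_dvd CHAR not_False_eq_True)
  moreover have "hermite_coeff k 1 1 = 0"
    using assms(1) q_eq by (intro hermite_coeff_eq_0) auto
  hence "of_nat (k + 2) * b = 0"
    by (simp add: hermite_coeff_def expansion_coeff_def)
  ultimately show ?thesis
    by simp
qed

lemma three_mult_of_nat_Suc:
  assumes "q = 3 * k + 2"
  shows "3 * of_nat (k + 1) = (1 :: 'a)"
  using of_nat_q unfolding assms by (simp add: algebra_simps)

lemma three_ne_0:
  assumes "q = 3 * k + 2"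
  shows "(3 :: 'a) \<noteq> 0"
  using three_mult_of_nat_Suc[OF assms] by (metis mult_zero_left zero_neq_one)

lemma nine_mult_of_nat_choose_two:
  assumes q_eq: "q = 3 * k + 2" and "k > 0"
  shows "9 * of_nat ((k + 1) choose 2) = (-1 :: 'a)"
proof -
  obtain e where q_power: "e > 0" "q = CHAR('a) ^ e"
    by (rule q_eq_CHAR_power)
  have "2 * (9 * ((k + 1) choose 2) + 1) = 2 * (q choose 2)"
    using two_mult_choose_two[of "k + 1"] two_mult_choose_two[of q]
    by (simp add: q_eq algebra_simps)
  hence "9 * ((k + 1) choose 2) + 1 = q choose 2"
    by simp
  also have "CHAR('a) dvd (q choose 2)"
    using prime_CHAR assms q_power by (intro prime_dvd_choose_if_prime_power_dvd[of _ e]) auto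
  finally have "of_nat (9 * ((k + 1) choose 2) + 1) = (0 :: 'a)"
    by (simp only: of_nat_eq_0_iff_char_dvd)
  thus ?thesis
    by (simp add: eq_neg_iff_add_eq_0 add.commute)
qed

lemma tr_square_eq_if_bij:
  assumes "bij f" and q_eq: "q = 3 * k + 2" and "k > 0"
  shows "tr c ^ 2 = nm b + 3 * nm c"
proof -
  define A B :: 'a where "A = of_nat ((k + 1) choose 2)" and "B = of_nat (k + 1)"
  have nine_A: "9 * A = -1" and three_B: "3 * B = 1"
    unfolding A_def B_def
    using nine_mult_of_nat_choose_two[OF q_eq \<open>k > 0\<close>] three_mult_of_nat_Suc[OF q_eq] by simp_all
  have "hermite_coeff (k + 1) 0 2 = 0"
    using assms by (intro hermite_coeff_eq_0) auto
  hence "0 = 9 * (B ^ 2 * (nm b + nm c) + A * (c ^ 2 + conj c ^ 2))"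
    by (simp add: hermite_coeff_def expansion_coeff_def A_def B_def nm_def numeral_2_eq_2
        algebra_simps)
  also have "\<dots> = (3 * B) ^ 2 * (nm b + nm c) + (9 * A) * (c ^ 2 + conj c ^ 2)"
    by (simp add: algebra_simps power2_eq_square)
  also have "\<dots> = (nm b + nm c) - (c ^ 2 + conj c ^ 2)"
    unfolding nine_A three_B by simp
  finally have "c ^ 2 + conj c ^ 2 = nm b + nm c"
    by simp
  thus ?thesis
    by (simp add: tr_def nm_def algebra_simps power2_eq_square)
qed

lemma b_eq_0_if_two_ne_0:
  assumes "bij f" and q_eq: "q = 3 * k + 2" and "k > 0" and two_ne_0: "(2 :: 'a) \<noteq> 0"
  shows "b = 0"
proof (rule ccontr)
  assume b_ne_0: "b \<noteq> 0"
  define K :: 'a where "K = of_nat k"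
  have three_K: "3 * K = -2"
    using of_nat_q unfolding q_eq K_def by (simp add: eq_neg_iff_add_eq_0 add.commute)
  have choose: "2 * of_nat ((k + 2) choose 2) = (K + 2) * (K + 1)"
    using arg_cong[OF two_mult_choose_two[of "k + 2"], of "of_nat :: nat \<Rightarrow> 'a"]
    by (simp add: K_def algebra_simps)
  have "hermite_coeff k 1 2 = 0"
    using assms by (intro hermite_coeff_eq_0) auto
  hence "0 = 9 * ((K + 2) * K * b * conj c + 2 * of_nat ((k + 2) choose 2) * b * c)"
    by (simp add: hermite_coeff_def expansion_coeff_def K_def numeral_2_eq_2 algebra_simps)
  also have "\<dots> = (3 * K + 6) * (3 * K) * b * conj c + (3 * K + 6) * (3 * K + 3) * b * c"
    unfolding choose by (simp add: algebra_simps)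
  also have "\<dots> = 2 * (2 * (b * (c - 2 * conj c)))"
    unfolding three_K by (simp add: algebra_simps)
  finally have "c - 2 * conj c = 0"
    using b_ne_0 two_ne_0 by (metis mult_eq_0_iff)
  hence c_eq: "c = 2 * conj c"
    by (simp only: right_minus_eq)
  have "3 * c = 2 * (2 * c) - c"
    by simp
  also have "2 * c = conj c"
    using arg_cong[OF c_eq, of conj] by simp
  also have "2 * conj c - c = 0"
    by (simp flip: c_eq)
  finally have "c = 0"
    using three_ne_0[OF q_eq] by simp
  with tr_square_eq_if_bij[OF assms(1) q_eq \<open>k > 0\<close>] show False
    using b_ne_0 by (simp add: tr_def)
qed

lemma hermite_coeff_if_two_eq_0:
  assumes two_eq_0: "(2 :: 'a) = 0"
  shows "hermite_coeff (8 * m + 3) 1 5 = b * c ^ 4"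
proof -
  define P Q where "P = [:c, b:]" and "Q = [:conj b, conj c:]"
  have P_square: "P ^ 2 = [:c ^ 2, 0, b ^ 2:]"
    using two_eq_0 by (simp add: P_def power2_eq_square flip: mult_2)
  have "P ^ 4 = P ^ 2 * P ^ 2"
    by (simp flip: power_add)
  also have "\<dots> = [:c ^ 4, 0, 0, 0, b ^ 4:]"
    unfolding P_square using two_eq_0 by (simp flip: mult_2 power_add)
  finally have P_power_4: "P ^ 4 = [:c ^ 4, 0, 0, 0, b ^ 4:]" .
  have odd_eq_1: "(3 :: 'a) = 1" "(5 :: 'a) = 1"
  proof -
    have "(3 :: 'a) = 2 + 1" "(5 :: 'a) = 2 * 2 + 1"
      by simp_all
    thus "(3 :: 'a) = 1" "(5 :: 'a) = 1"
      unfolding two_eq_0 by simp_all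
  qed
  have choose: "of_nat ((8 * m + n) choose r) = (of_nat (n choose r) :: 'a)" if "r \<le> 5" for n r
    unfolding of_nat_eq_iff_cong_CHAR CHAR_eq_2_if_two_eq_0[OF two_eq_0]
    by (rule choose_add_cong_if_prime_power_dvd[of 2 3]) (use that in auto)
  have index_eq: "8 * m + 3 + 2 * 1 = 8 * m + 5"
    by simp
  have "hermite_coeff (8 * m + 3) 1 5 = (\<Sum>r\<le>5. of_nat (5 choose r) * of_nat (3 choose (5 - r)) *
      coeff (P ^ r * Q ^ (5 - r)) (1 + (5 - r)))"
    unfolding hermite_coeff_def expansion_coeff_def P_def Q_def of_nat_mult index_eq
    by (intro sum.cong refl) (simp only: choose atMost_iff diff_le_self)
  also have "{..5::nat} = {0, 1, 2, 3, 4, 5}"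
    by auto
  also have "(\<Sum>r\<in>{0, 1, 2, 3, 4, 5}. of_nat (5 choose r) * of_nat (3 choose (5 - r)) *
      coeff (P ^ r * Q ^ (5 - r)) (1 + (5 - r))) = coeff (P ^ 4 * Q) 2 + coeff (P ^ 4 * P) 1"
    using two_eq_0 odd_eq_1 by (simp add: numeral_eq_Suc mult_ac)
  also have "\<dots> = b * c ^ 4"
    unfolding P_power_4 by (simp add: P_def Q_def numeral_2_eq_2)
  finally show ?thesis .
qed

lemma b_eq_0_if_two_eq_0:
  assumes "bij f" and q_eq: "q = 3 * k + 2" and "k > 0" and two_eq_0: "(2 :: 'a) = 0"
  shows "b = 0"
proof -
  obtain e where q_power: "q = 2 ^ e"
    using q_eq_CHAR_power CHAR_eq_2_if_two_eq_0[OF two_eq_0] by metis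
  have "e \<noteq> 0" "e \<noteq> 1" "e \<noteq> 2"
    using q_eq \<open>k > 0\<close> q_power by (auto intro!: gr0I)
  hence "(8::nat) dvd q"
    using q_power le_imp_power_dvd[of 3 e "2::nat"] by simp
  then obtain m where k_eq: "k = 8 * m + 2"
    using q_eq by (intro that[of "k div 8"]) presburger
  have "hermite_coeff (8 * m + 3) 1 5 = 0"
    using assms k_eq by (intro hermite_coeff_eq_0) auto
  hence "b = 0 \<or> c = 0"
    using hermite_coeff_if_two_eq_0[OF two_eq_0] by simp
  thus ?thesis
    using tr_square_eq_if_bij[OF assms(1-3)] by (auto simp: tr_def)
qed

lemma q_eq_2_if_bij:
  assumes "bij f" "b \<noteq> 0"
  shows "q = 2"
proof (rule ccontr)
  assume "q \<noteq> 2"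
  define k where "k = q div 3"
  have "q mod 3 = 1 \<or> 3 dvd q \<or> q = 3 * k + 2"
    unfolding k_def by presburger
  then consider "q mod 3 = 1" | "3 dvd q" | "q = 3 * k + 2"
    by blast
  thus False
  proof cases
    case 3
    hence "k > 0"
      using \<open>q \<noteq> 2\<close> by simp
    thus ?thesis
      using assms 3 b_eq_0_if_two_ne_0 b_eq_0_if_two_eq_0 by blast
  qed (use assms not_bij_if_mod_3_eq_1 b_eq_0_if_three_dvd in auto)
qed

subsection \<open>Classification of the permutations\<close>

lemma f_eq_if_b_eq_0: "b = 0 \<Longrightarrow> f x = x * (nm x + c)"
  unfolding f_def by (simp add: nm_def power2_eq_square algebra_simps)

lemma nm_f_if_b_eq_0: "b = 0 \<Longrightarrow> nm (f x) = norm_cubic c (nm x)"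
  unfolding f_eq_if_b_eq_0 nm_mult norm_cubic_def by (simp add: nm_def[of "_ + c"] mult.assoc)

lemma nm_eq_if_nm_f_eq:
  assumes "inj f" "b = 0" "nm (f x) = nm (f y)"
  shows "nm x = nm y"
proof (cases "f y = 0")
  case True
  hence "f x = f y"
    using assms(3) by simp
  hence "x = y"
    by (rule injD[OF \<open>inj f\<close>])
  thus ?thesis
    by simp
next
  case False
  define v where "v = f x / f y"
  have "nm v = 1"
    using assms(3) False by (simp add: v_def nm_divide)
  hence nm_vy: "nm (v * y) = nm y"
    by (simp add: nm_mult)
  hence "f (v * y) = v * f y"
    by (simp add: f_eq_if_b_eq_0[OF assms(2)] mult.assoc)
  also have "\<dots> = f x"
    using False by (simp add: v_def)
  finally have "v * y = x"
    by (rule injD[OF \<open>inj f\<close>])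
  thus ?thesis
    using nm_vy by simp
qed

lemma bij_f_iff_inj_on_norm_cubic:
  assumes "b = 0"
  shows "bij f \<longleftrightarrow> inj_on (norm_cubic c) base_field"
proof
  assume "bij f"
  show "inj_on (norm_cubic c) base_field"
  proof (rule inj_onI)
    fix t u assume "t \<in> base_field" "u \<in> base_field" "norm_cubic c t = norm_cubic c u"
    moreover from this obtain x y where "nm x = t" "nm y = u"
      using ex_nm_eq_if_conj_eq by blast
    ultimately show "t = u"
      using nm_eq_if_nm_f_eq[OF bij_is_inj[OF \<open>bij f\<close>] assms, of x y]
      by (simp add: nm_f_if_b_eq_0[OF assms])
  qed
next
  assume inj: "inj_on (norm_cubic c) base_field"
  have "inj f"
  proof (rule injI)
    fix x y assume xy: "f x = f y"
    have nm_eq: "nm x = nm y"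
      by (rule inj_onD[OF inj]) (simp_all add: xy flip: nm_f_if_b_eq_0[OF assms])
    show "x = y"
    proof (cases "nm y + c = 0")
      case True
      hence "norm_cubic c (nm y) = norm_cubic c 0"
        by (simp add: norm_cubic_def)
      hence "nm y = 0"
        by (rule inj_onD[OF inj]) simp_all
      thus ?thesis
        using nm_eq by simp
    next
      case False
      thus ?thesis
        using xy by (simp add: f_eq_if_b_eq_0[OF assms] nm_eq)
    qed
  qed
  thus "bij f"
    by (simp add: bij_iff_inj_if_finite)
qed

lemma bij_iff_if_q_eq_2:
  assumes "q = 2"
  shows "bij f \<longleftrightarrow> (b = 0 \<longleftrightarrow> c \<noteq> 1)"
proof -
  have two_eq_0: "(2 :: 'a) = 0"
    using of_nat_q assms by simp
  hence minus: "- x = x" for x :: 'a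
    by (simp add: neg_eq_iff_add_eq_0 flip: mult_2)
  have f_eq: "f x = x * ((1 + c) + b * x)" for x
  proof -
    have "x ^ 2 * conj x = x"
      using conj_conj[of x] by (simp add: conj_eq assms flip: power_mult power_add)
    thus ?thesis
      by (simp add: f_def conj_eq assms power2_eq_square algebra_simps)
  qed
  have "f (x - y) = f x - f y" for x y
    using two_eq_0 unfolding f_eq by (simp add: algebra_simps)
  hence "inj f \<longleftrightarrow> (\<forall>x. f x = 0 \<longrightarrow> x = 0)"
    unfolding inj_def by (metis diff_zero eq_iff_diff_eq_0 f_0)
  also have "\<dots> \<longleftrightarrow> (b = 0 \<longleftrightarrow> 1 + c \<noteq> 0)"
  proof (cases "b = 0")
    case True
    thus ?thesis
      unfolding f_eq by (auto dest: spec[of _ 1])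
  next
    case False
    hence "f x = 0 \<longleftrightarrow> x = 0 \<or> x = (1 + c) / b" for x
      unfolding f_eq mult_eq_0_iff by (simp add: eq_divide_eq add_eq_0_iff minus mult.commute)
    thus ?thesis
      using False by auto
  qed
  also have "1 + c \<noteq> 0 \<longleftrightarrow> c \<noteq> 1"
    by (simp add: add_eq_0_iff minus)
  finally show ?thesis
    unfolding bij_iff_inj_if_finite .
qed

lemma bij_f_iff_if_b_ne_0:
  assumes "b \<noteq> 0"
  shows "bij f \<longleftrightarrow> q = 2 \<and> c = 1"
  using assms q_eq_2_if_bij bij_iff_if_q_eq_2 by blast

lemma tr_square_eq_if_bij_and_b_eq_0:
  assumes "bij f" and b_eq_0: "b = 0"
  shows "tr c ^ 2 = 3 * nm c"
proof -
  define k where "k = q div 3"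
  have "q mod 3 \<noteq> 1"
    using assms(1) not_bij_if_mod_3_eq_1 by blast
  hence "3 dvd q \<or> q = 3 * k + 2"
    unfolding k_def by presburger
  then consider "3 dvd q" | "q = 2" | "q = 3 * k + 2" "k > 0"
    by fastforce
  thus ?thesis
  proof cases
    case 1
    hence "CHAR('a) = 3"
      by (intro CHAR_eq_if_prime_dvd_q) auto
    hence "(3 :: 'a) = 0"
      by (metis of_nat_CHAR of_nat_numeral)
    thus ?thesis
      using assms tr_eq_0_if_inj_on_norm_cubic bij_f_iff_inj_on_norm_cubic by simp
  next
    case 2
    thus ?thesis
      using assms bij_iff_if_q_eq_2 tr_square_eq_if_q_eq_2 by simp
  next
    case 3
    thus ?thesis
      using tr_square_eq_if_bij[OF assms(1)] b_eq_0 by simp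
  qed
qed

lemma bij_f_iff_if_b_eq_0:
  assumes "b = 0"
  shows "bij f \<longleftrightarrow> q mod 3 \<noteq> 1 \<and> tr c ^ 2 = 3 * nm c"
  using assms not_bij_if_mod_3_eq_1 tr_square_eq_if_bij_and_b_eq_0
    bij_f_iff_inj_on_norm_cubic inj_on_norm_cubic by blast

end

theorem theorem1p3:
  fixes q :: nat and b c :: "'a::{field, finite}"
  assumes "\<exists>p k. prime p \<and> k \<ge> 1 \<and> q = p ^ k"
    and "CARD('a) = q ^ 2"
  shows "bij (\<lambda>x::'a. x ^ (q + 2) + b * x ^ q + c * x) \<longleftrightarrow>
    ((q mod 3 \<noteq> 1 \<and> b = 0 \<and>
        (c ^ (q - 1)) ^ 3 - (c ^ (q - 1)) ^ 2 + c ^ (q - 1) = 0)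
     \<or> (q = 2 \<and> b \<noteq> 0 \<and> c = 1))"
proof -
  interpret trinomial q "\<lambda>x. x ^ q" b c
    using assms by unfold_locales (auto simp: primepow_def Suc_le_eq)
  have "(\<lambda>x. x ^ (q + 2) + b * x ^ q + c * x) = f"
    by (simp add: f_def fun_eq_iff power_add power2_eq_square mult_ac)
  thus ?thesis
    unfolding root_iff_tr_square_eq using bij_f_iff_if_b_eq_0 bij_f_iff_if_b_ne_0 by auto
qed

end
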